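(* Let $d\ge 1$, let $(X,\mathcal F,\nu)$ be a probability space such that $L^2(\nu)$ is separable, and let $\mu=\nu^{\mathbb Z^d}$ be the product measure on $\Omega=X^{\mathbb Z^d}$. If $f\in\mathcal D$ satisfies $\langle f\rangle=0$ and $\langle f|f\rangle=0$, then $f\in\mathfrak G$. Equivalently, $\{f\in\mathcal D:\langle f|f\rangle=0\}$ (the intersection of the kernel of $\langle\cdot|\cdot\rangle$ with $\mathcal D$) is the direct sum of the space of constant functions and $\mathfrak G$.
   Context: $\Omega=X^{\mathbb Z^d}$ carries the product $\sigma$-algebra; its elements are written $\eta=(\eta_x)_{x\in\mathbb Z^d}$. $L^2(\mu)$ is the space of real-valued square-integrable functions and $\langle\cdot\rangle$ denotes expectation with respect to $\mu$. A function on $\Omega$ is called local if it depends only on finitely many coordinates $\eta_x$. $\mathcal D:=\{f\in L^2(\mu): f \text{ local}\}$ (functions identified when $\mu$-a.e. equal). Shifts: $(\tau_z\eta)_x=\eta_{x-z}$ and $(\tau_z f)(\eta)=f(\tau_z\eta)$ for $z\in\mathbb Z^d$; $\tau^{\alpha}:=\tau_{e_\alpha}$, where $e_\alpha$ is the unit vector in the $\alpha$-th direction. For $f,g\in\mathcal D$, $$\langle f|g\rangle:=\sum_{x\in\mathbb Z^d}\big(\langle (\tau_x f)\, g\rangle-\langle f\rangle\langle g\rangle\big),$$ a sum with finitely many nonzero terms because $\mu$ is a product measure. The gradient space is $$\mathfrak G:=\Big\{\sum_{\alpha=1}^d(\tau^{\alpha}g_\alpha-g_\alpha)\;:\; g_\alpha\in\mathcal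 D,\ \alpha=1,\dots,d\Big\}.$$ *)

theory Defs
  imports "HOL-Probability.Probability"
begin

(* Elements of L2-type spaces are represented by functions. Sets of functions that stand for
   subspaces of L2 are closed under almost-everywhere equality, so that equality of such sets
   is equality of the corresponding subspaces. *)

definition L2 :: "'a measure \<Rightarrow> ('a \<Rightarrow> real) set" where
  "L2 M = {f \<in> borel_measurable M. integrable M (\<lambda>x. (f x)\<^sup>2)}"

definition L2_separable :: "'a measure \<Rightarrow> bool" where
  "L2_separable M \<longleftrightarrow> (\<exists>D. countable D \<and> D \<subseteq> L2 M \<and>
     (\<forall>f\<in>L2 M. \<forall>\<epsilon>>0. \<exists>g\<in>D. sqrt (\<integral>x. (f x - g x)\<^sup>2 \<partial>M) < \<epsilon>))"

text \<open>Configurations: the lattice is \<open>int ^ 'd\<close>, of dimension \<open>CARD('d)\<close>.\<close>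

type_synonym ('d, 'x) config = "(int, 'd) vec \<Rightarrow> 'x"

definition product_law :: "'x measure \<Rightarrow> ('d::finite, 'x) config measure" where
  "product_law \<nu> = PiM UNIV (\<lambda>_. \<nu>)"

definition shift_config :: "int ^ 'd \<Rightarrow> ('d::finite, 'x) config \<Rightarrow> ('d, 'x) config" where
  "shift_config z \<eta> = (\<lambda>x. \<eta> (x - z))"

definition shift_fun ::
  "int ^ 'd \<Rightarrow> (('d::finite, 'x) config \<Rightarrow> real) \<Rightarrow> ('d, 'x) config \<Rightarrow> real" where
  "shift_fun z f = (\<lambda>\<eta>. f (shift_config z \<eta>))"

definition local_fun :: "'x measure \<Rightarrow> (('d::finite, 'x) config \<Rightarrow> real) \<Rightarrow> bool" where
  "local_fun \<nu> f \<longleftrightarrow> (\<exists>S. finite S \<and>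
     (\<forall>\<eta> \<in> space (product_law \<nu>). \<forall>\<omega> \<in> space (product_law \<nu>).
        (\<forall>x\<in>S. \<eta> x = \<omega> x) \<longrightarrow> f \<eta> = f \<omega>))"

text \<open>The square-integrable functions that are almost everywhere equal to a local function.\<close>

definition local_L2 :: "'x measure \<Rightarrow> (('d::finite, 'x) config \<Rightarrow> real) set" where
  "local_L2 \<nu> = {f \<in> L2 (product_law \<nu>).
     \<exists>h \<in> borel_measurable (product_law \<nu>). local_fun \<nu> h \<and> (AE \<eta> in product_law \<nu>. f \<eta> = h \<eta>)}"

definition mean :: "'x measure \<Rightarrow> (('d::finite, 'x) config \<Rightarrow> real) \<Rightarrow> real" where
  "mean \<nu> f = (\<integral>\<eta>. f \<eta> \<partial>product_law \<nu>)"

text \<open>For \<open>f\<close> and \<open>g\<close> in \<open>local_L2 \<nu>\<close> and a probability measure \<open>\<nu>\<close>, only finitely many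
  terms of this sum are nonzero, so \<open>infsum\<close> is a finite sum.\<close>

definition shift_form ::
  "'x measure \<Rightarrow> (('d::finite, 'x) config \<Rightarrow> real) \<Rightarrow> (('d, 'x) config \<Rightarrow> real) \<Rightarrow> real" where
  "shift_form \<nu> f g =
     (\<Sum>\<^sub>\<infinity>x. mean \<nu> (\<lambda>\<eta>. shift_fun x f \<eta> * g \<eta>) - mean \<nu> f * mean \<nu> g)"

definition gradient_space :: "'x measure \<Rightarrow> (('d::finite, 'x) config \<Rightarrow> real) set" where
  "gradient_space \<nu> = {f \<in> L2 (product_law \<nu>).
     \<exists>g :: 'd \<Rightarrow> ('d, 'x) config \<Rightarrow> real. (\<forall>\<alpha>. g \<alpha> \<in> local_L2 \<nu>) \<and>
       (AE \<eta> in product_law \<nu>. f \<eta> = (\<Sum>\<alpha>\<in>UNIV. shift_fun (axis \<alpha> 1) (g \<alpha>) \<eta> - g \<alpha> \<eta>))}"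

definition constant_space :: "'x measure \<Rightarrow> (('d::finite, 'x) config \<Rightarrow> real) set" where
  "constant_space \<nu> = {f \<in> L2 (product_law \<nu>). \<exists>c. AE \<eta> in product_law \<nu>. f \<eta> = c}"

text \<open>The representatives of the zero vector.\<close>

definition null_space :: "'x measure \<Rightarrow> (('d::finite, 'x) config \<Rightarrow> real) set" where
  "null_space \<nu> = {f \<in> L2 (product_law \<nu>). AE \<eta> in product_law \<nu>. f \<eta> = 0}"

end

theory Submission
  imports Defs
begin

text \<open>
  The kernel of the shift form is found by splitting a local function, site after site, into
  innovations. Order the sites of the lattice by a linear height \<open>\<phi>\<close> that is injective
  (\<open>ex_injective_height\<close>), so that the order is total and invariant under translations.
  If \<open>h\<close> depends on the finite set \<open>T\<close> of sites and \<open>m\<close> is the highest one, average \<open>h\<close> over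
  \<open>\<eta>\<^sub>m\<close> (\<open>resample\<close>): the average no longer depends on \<open>\<eta>\<^sub>m\<close>, and the remainder has conditional
  mean zero given all the coordinates other than \<open>\<eta>\<^sub>m\<close>. Translating the remainder so that
  \<open>m\<close> moves to the origin changes it by a gradient only (\<open>shift_diff_in_gradient_space\<close>). Repeating
  this until no site is left gives \<open>h\<close> as the sum of its mean, a function \<open>g\<close> and a gradient, where
  \<open>g\<close> depends on sites of height at most \<open>0\<close> and is orthogonal to every function that does not depend on the coordinate at the origin (\<open>decompose_innovation_gradient\<close>).

  Such a \<open>g\<close> is orthogonal to its translates by nonzero vectors: of two distinct translates, the one whose top site
  is lower does not depend on the top site of the other one. Hence the shift form of \<open>g\<close>
  with itself keeps only its term at \<open>x = 0\<close>, which is the second moment of \<open>g\<close>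
  (\<open>shift_form_innovation\<close>). Gradients lie in the kernel of the form because it is shift invariant
  in each argument, and constants do because the product of the means is subtracted. So if the form vanishes at \<open>h\<close>, the second moment of \<open>g\<close> vanishes,
  \<open>g\<close> is null, and \<open>h\<close> is its mean plus a gradient (\<open>shift_form_kernel\<close>). The sum of the two spaces is
  direct because gradients have mean zero.
\<close>

section \<open>Square-integrable functions\<close>

lemma L2_mult_integrable:
  assumes "f \<in> L2 M" "g \<in> L2 M"
  shows "integrable M (\<lambda>x. f x * g x)"
proof (rule Bochner_Integration.integrable_bound)
  show "integrable M (\<lambda>x. (f x)\<^sup>2 + (g x)\<^sup>2)"
    using assms by (auto simp: L2_def)
  have "\<bar>a * b\<bar> \<le> a\<^sup>2 + b\<^sup>2" for a b :: real
    using sum_squares_bound[of "\<bar>a\<bar>" "\<bar>b\<bar>"] mult_nonneg_nonneg[of "\<bar>a\<bar>" "\<bar>b\<bar>"]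
    unfolding abs_mult power2_abs by linarith
  then show "AE x in M. norm (f x * g x) \<le> norm ((f x)\<^sup>2 + (g x)\<^sup>2)"
    by simp
qed (use assms in \<open>auto simp: L2_def\<close>)

lemma L2_add: "f \<in> L2 M \<Longrightarrow> g \<in> L2 M \<Longrightarrow> (\<lambda>x. f x + g x) \<in> L2 M"
  using L2_mult_integrable[of f M g]
  by (auto simp: L2_def power2_sum mult.assoc intro!: borel_measurable_add)

lemma L2_scale: "f \<in> L2 M \<Longrightarrow> (\<lambda>x. c * f x) \<in> L2 M"
  by (auto simp: L2_def power_mult_distrib intro!: borel_measurable_times)

lemma L2_diff: "f \<in> L2 M \<Longrightarrow> g \<in> L2 M \<Longrightarrow> (\<lambda>x. f x - g x) \<in> L2 M"
  using L2_add[of f M "\<lambda>x. (-1) * g x"] L2_scale[of g M "-1"] by simp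

lemma L2_zero: "(\<lambda>_. 0) \<in> L2 M"
  by (simp add: L2_def)

lemma L2_cong_AE:
  assumes "f \<in> L2 M" "g \<in> borel_measurable M" "AE x in M. f x = g x"
  shows "g \<in> L2 M"
proof -
  have "integrable M (\<lambda>x. (g x)\<^sup>2) \<longleftrightarrow> integrable M (\<lambda>x. (f x)\<^sup>2)"
    using assms by (intro integrable_cong_AE) (auto simp: L2_def)
  then show ?thesis using assms by (simp add: L2_def)
qed

lemma L2_compose_measure_preserving:
  assumes [measurable]: "T \<in> measurable M N" and "distr M N T = N" and "f \<in> L2 N"
  shows "(\<lambda>x. f (T x)) \<in> L2 M"
proof -
  have [measurable]: "f \<in> borel_measurable N" using assms by (simp add: L2_def)
  have "integrable M (\<lambda>x. (f (T x))\<^sup>2)"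
    using assms integrable_distr_eq[of T M N "\<lambda>x. (f x)\<^sup>2"] by (simp add: L2_def)
  then show ?thesis by (simp add: L2_def)
qed

context prob_space
begin

lemma L2_const: "(\<lambda>_. c) \<in> L2 M"
  by (simp add: L2_def)

lemma L2_integrable: "f \<in> L2 M \<Longrightarrow> integrable M f"
  using L2_mult_integrable[OF _ L2_const[of 1]] by simp

text \<open>Jensen's inequality for the square: the difference of the two sides is the variance.\<close>

lemma expectation_square_le:
  fixes f :: "'a \<Rightarrow> real"
  assumes "integrable M (\<lambda>x. (f x)\<^sup>2)" "f \<in> borel_measurable M"
  shows "(expectation f)\<^sup>2 \<le> expectation (\<lambda>x. (f x)\<^sup>2)"
proof -
  have "integrable M f" using assms by (auto intro!: L2_integrable simp: L2_def)
  then show ?thesis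
    using variance_eq[of f] variance_positive[of f] assms by simp
qed

end

section \<open>The product law: shifts and dependence on coordinates\<close>

text \<open>\<open>local_fun\<close> with the set of coordinates made explicit. The set may be infinite: \<open>- {x}\<close> expresses that
  the coordinate at \<open>x\<close> has no influence.\<close>

definition depends_on ::
  "'x measure \<Rightarrow> (int ^ 'd) set \<Rightarrow> (('d::finite, 'x) config \<Rightarrow> real) \<Rightarrow> bool" where
  "depends_on \<nu> S f \<longleftrightarrow>
     (\<forall>\<eta> \<in> space (product_law \<nu>). \<forall>\<omega> \<in> space (product_law \<nu>).
        (\<forall>x\<in>S. \<eta> x = \<omega> x) \<longrightarrow> f \<eta> = f \<omega>)"

lemma depends_onD:
  "depends_on \<nu> S f \<Longrightarrow> \<eta> \<in> space (product_law \<nu>) \<Longrightarrow> \<omega> \<in> space (product_law \<nu>) \<Longrightarrow>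
     (\<And>x. x \<in> S \<Longrightarrow> \<eta> x = \<omega> x) \<Longrightarrow> f \<eta> = f \<omega>"
  unfolding depends_on_def by blast

lemma depends_on_mono: "depends_on \<nu> S f \<Longrightarrow> S \<subseteq> T \<Longrightarrow> depends_on \<nu> T f"
  unfolding depends_on_def by blast

lemma depends_on_add:
  "depends_on \<nu> S f \<Longrightarrow> depends_on \<nu> T g \<Longrightarrow> depends_on \<nu> (S \<union> T) (\<lambda>\<eta>. f \<eta> + g \<eta>)"
  unfolding depends_on_def by (metis UnCI)

lemma depends_on_scale: "depends_on \<nu> S f \<Longrightarrow> depends_on \<nu> S (\<lambda>\<eta>. c * f \<eta>)"
  unfolding depends_on_def by metis

lemma depends_on_diff:
  "depends_on \<nu> S f \<Longrightarrow> depends_on \<nu> S g \<Longrightarrow> depends_on \<nu> S (\<lambda>\<eta>. f \<eta> - g \<eta>)"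
  unfolding depends_on_def by metis

lemma depends_on_const: "depends_on \<nu> S (\<lambda>_. c)"
  unfolding depends_on_def by blast

lemma space_product_law:
  "space (product_law \<nu> :: ('d::finite, 'x) config measure) = {\<eta>. \<forall>x. \<eta> x \<in> space \<nu>}"
  by (auto simp: product_law_def space_PiM)

lemma shift_config_measurable [measurable]:
  "shift_config z \<in> measurable (product_law \<nu>) (product_law \<nu>)"
  unfolding shift_config_def product_law_def
  by (rule measurable_PiM_single') (auto simp: space_PiM)

lemma shift_config_space:
  "\<eta> \<in> space (product_law \<nu>) \<Longrightarrow> shift_config z \<eta> \<in> space (product_law \<nu>)"
  by (simp add: space_product_law shift_config_def)

lemma depends_on_shift:
  assumes "depends_on \<nu> S f"
  shows "depends_on \<nu> ((\<lambda>x. x - z) ` S) (shift_fun z f)"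
  unfolding depends_on_def shift_fun_def
  by (intro ballI impI depends_onD[OF assms] shift_config_space) (auto simp: shift_config_def)

lemma shift_fun_shift_fun: "shift_fun x (shift_fun y f) = shift_fun (x + y) f"
  by (simp add: shift_fun_def shift_config_def algebra_simps)

lemma shift_fun_0: "shift_fun 0 f = f"
  by (simp add: shift_fun_def shift_config_def)

context
  fixes \<nu> :: "'x measure"
  assumes prob: "prob_space \<nu>"
begin

lemma prob_space_product_law: "prob_space (product_law \<nu>)"
  unfolding product_law_def by (intro prob_space_PiM prob)

lemma shift_config_preserves:
  "distr (product_law \<nu>) (product_law \<nu>) (shift_config z :: ('d::finite, 'x) config \<Rightarrow> _)
     = product_law \<nu>"
proof -
  have "inj_on (\<lambda>x. x - z) UNIV" by (simp add: inj_on_def)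
  from distr_PiM_reindex[of UNIV "\<lambda>_. \<nu>" "\<lambda>x. x - z" UNIV, OF prob this] show ?thesis
    by (simp add: product_law_def shift_config_def[abs_def] restrict_def)
qed

lemma mean_shift:
  "f \<in> borel_measurable (product_law \<nu>) \<Longrightarrow>
     mean \<nu> (shift_fun z f) = mean \<nu> (f :: ('d::finite, 'x) config \<Rightarrow> real)"
  unfolding mean_def shift_fun_def
  by (subst (2) shift_config_preserves[of z, symmetric]) (simp add: integral_distr)

lemma shift_fun_L2: "f \<in> L2 (product_law \<nu>) \<Longrightarrow> shift_fun z f \<in> L2 (product_law \<nu>)"
  unfolding shift_fun_def
  by (rule L2_compose_measure_preserving[OF shift_config_measurable shift_config_preserves])

lemma AE_shift_fun:
  fixes f g :: "('d::finite, 'x) config \<Rightarrow> real"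
  assumes "AE \<eta> in product_law \<nu>. f \<eta> = g \<eta>"
  shows "AE \<eta> in product_law \<nu>. shift_fun z f \<eta> = shift_fun z g \<eta>"
proof -
  have "AE \<eta> in distr (product_law \<nu>) (product_law \<nu>) (shift_config z). f \<eta> = g \<eta>"
    unfolding shift_config_preserves by (rule assms)
  from AE_distrD[OF shift_config_measurable this] show ?thesis
    by (simp add: shift_fun_def)
qed

section \<open>Resampling one coordinate\<close>

text \<open>The conditional expectation given all the coordinates other than the one at \<open>x\<close>, written as an integral
  so that dependence on coordinates can be read off pointwise. Where the section of \<open>f\<close> is not
  integrable, the integral takes the default value \<open>0\<close>; for integrable \<open>f\<close> this happens only on a null set.\<close>

definition resample ::
  "int ^ 'd \<Rightarrow> (('d::finite, 'x) config \<Rightarrow> real) \<Rightarrow> ('d, 'x) config \<Rightarrow> real" where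
  "resample x f \<eta> = (\<integral>y. f (\<eta>(x := y)) \<partial>\<nu>)"

lemma update_measurable:
  "(\<lambda>(y, \<eta>). \<eta>(x := y)) \<in> measurable (\<nu> \<Otimes>\<^sub>M product_law \<nu>) (product_law \<nu>)"
  unfolding product_law_def case_prod_beta
  by (rule measurable_PiM_single') (auto simp: space_PiM space_pair_measure fun_upd_def)

text \<open>Overwriting one coordinate by an independent sample of \<open>\<nu>\<close> leaves the product law unchanged. The
  integral identities for \<open>resample\<close> are Fubini's theorem transported along this map.\<close>

lemma update_preserves:
  "distr (\<nu> \<Otimes>\<^sub>M product_law \<nu>) (product_law \<nu>) (\<lambda>(y, \<eta>). \<eta>(x := y))
     = (product_law \<nu> :: ('d::finite, 'x) config measure)"
  using distr_pair_PiM_eq_PiM[of UNIV "\<lambda>_. \<nu>" x, OF prob prob] by (simp add: product_law_def)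

lemma resample_integrable:
  fixes f :: "('d::finite, 'x) config \<Rightarrow> real"
  assumes "integrable (product_law \<nu>) f"
  shows "mean \<nu> (resample x f) = mean \<nu> f" "integrable (product_law \<nu>) (resample x f)"
    "AE \<eta> in product_law \<nu>. integrable \<nu> (\<lambda>y. f (\<eta>(x := y)))"
proof -
  interpret nu: prob_space \<nu> by (rule prob)
  interpret mu: prob_space "product_law \<nu> :: ('d, 'x) config measure"
    by (rule prob_space_product_law)
  interpret pair_sigma_finite \<nu> "product_law \<nu> :: ('d, 'x) config measure" ..
  note [measurable] = update_measurable
  have m: "f \<in> borel_measurable (product_law \<nu>)" using assms by auto
  have int: "integrable (\<nu> \<Otimes>\<^sub>M product_law \<nu>) (\<lambda>(y, \<eta>). f (\<eta>(x := y)))"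
    using integrable_distr_eq[OF update_measurable m, of x] assms
    unfolding update_preserves by (simp add: case_prod_beta')
  have "mean \<nu> f = (\<integral>p. f ((\<lambda>(y, \<eta>). \<eta>(x := y)) p) \<partial>(\<nu> \<Otimes>\<^sub>M product_law \<nu>))"
    unfolding mean_def
    by (subst update_preserves[of x, symmetric]) (rule integral_distr[OF update_measurable m])
  also have "\<dots> = (\<integral>\<eta>. (\<integral>y. f (\<eta>(x := y)) \<partial>\<nu>) \<partial>product_law \<nu>)"
    using integral_snd[OF int] by (simp add: case_prod_beta')
  finally show "mean \<nu> (resample x f) = mean \<nu> f"
    by (simp add: resample_def mean_def)
  show "integrable (product_law \<nu>) (resample x f)"
    using integrable_snd[OF int] by (simp add: resample_def[abs_def])
  show "AE \<eta> in product_law \<nu>. integrable \<nu> (\<lambda>y. f (\<eta>(x := y)))"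
    using AE_integrable_snd[OF int] by simp
qed

text \<open>Jensen's inequality on almost every section bounds the square of the average by the average of the
  square, which is integrable.\<close>

lemma resample_L2:
  fixes f :: "('d::finite, 'x) config \<Rightarrow> real"
  assumes "f \<in> L2 (product_law \<nu>)"
  shows "resample x f \<in> L2 (product_law \<nu>)"
proof -
  interpret nu: prob_space \<nu> by (rule prob)
  interpret mu: prob_space "product_law \<nu> :: ('d, 'x) config measure"
    by (rule prob_space_product_law)
  have sq: "integrable (product_law \<nu>) (\<lambda>\<eta>. (f \<eta>)\<^sup>2)" and m: "f \<in> borel_measurable (product_law \<nu>)"
    using assms by (auto simp: L2_def)
  have rm: "resample x f \<in> borel_measurable (product_law \<nu>)"
    using resample_integrable(2)[OF mu.L2_integrable[OF assms]] by auto
  have section_meas: "(\<lambda>y. f (\<eta>(x := y))) \<in> borel_measurable \<nu>"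
    if "\<eta> \<in> space (product_law \<nu>)" for \<eta>
  proof -
    have "(\<lambda>y. (y, \<eta>)) \<in> measurable \<nu> (\<nu> \<Otimes>\<^sub>M product_law \<nu>)" using that by simp
    from measurable_compose[OF measurable_compose[OF this update_measurable] m]
    show ?thesis by simp
  qed
  have "AE \<eta> in product_law \<nu>. norm ((resample x f \<eta>)\<^sup>2) \<le> norm (resample x (\<lambda>\<eta>. (f \<eta>)\<^sup>2) \<eta>)"
    using resample_integrable(3)[OF sq, of x] AE_space
  proof eventually_elim
    case (elim \<eta>)
    then show ?case
      using nu.expectation_square_le[OF elim(1) section_meas[OF elim(2)]]
      by (simp add: resample_def)
  qed
  with rm show ?thesis
    unfolding L2_def
    by (auto intro!: Bochner_Integration.integrable_bound[OF resample_integrable(2)[OF sq, of x]])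
qed

lemma depends_on_resample:
  assumes "depends_on \<nu> S f"
  shows "depends_on \<nu> (S - {x}) (resample x f)"
  unfolding depends_on_def resample_def
  by (intro ballI impI Bochner_Integration.integral_cong refl depends_onD[OF assms])
    (auto simp: space_product_law)

text \<open>A factor that ignores the coordinate at \<open>x\<close> can be pulled out of the average over it; so \<open>resample x\<close> is the
  orthogonal projection onto the functions that do not depend on that coordinate.\<close>

lemma mean_mult_resample:
  fixes u v :: "('d::finite, 'x) config \<Rightarrow> real"
  assumes "u \<in> L2 (product_law \<nu>)" "v \<in> L2 (product_law \<nu>)" "depends_on \<nu> (- {x}) u"
  shows "mean \<nu> (\<lambda>\<eta>. u \<eta> * resample x v \<eta>) = mean \<nu> (\<lambda>\<eta>. u \<eta> * v \<eta>)"
proof -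
  have "u (\<eta>(x := y)) = u \<eta>" if "\<eta> \<in> space (product_law \<nu>)" "y \<in> space \<nu>" for \<eta> y
    using that by (intro depends_onD[OF assms(3)]) (auto simp: space_product_law)
  then have "resample x (\<lambda>\<eta>. u \<eta> * v \<eta>) \<eta> = u \<eta> * resample x v \<eta>"
    if "\<eta> \<in> space (product_law \<nu>)" for \<eta>
    using that by (simp add: resample_def cong: Bochner_Integration.integral_cong)
  then have "mean \<nu> (resample x (\<lambda>\<eta>. u \<eta> * v \<eta>)) = mean \<nu> (\<lambda>\<eta>. u \<eta> * resample x v \<eta>)"
    unfolding mean_def by (intro Bochner_Integration.integral_cong) auto
  with resample_integrable(1)[OF L2_mult_integrable[OF assms(1,2)]] show ?thesis
    by simp
qed

text \<open>Independence of disjoint blocks of coordinates: the coordinates of \<open>B\<close> are averaged out of \<open>v\<close> one at a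
  time, and none of these averages is seen by \<open>u\<close>. At the end \<open>v\<close> has become a constant.\<close>

lemma mean_mult_disjoint:
  fixes u v :: "('d::finite, 'x) config \<Rightarrow> real"
  assumes u: "u \<in> L2 (product_law \<nu>)" "depends_on \<nu> A u"
    and v: "v \<in> L2 (product_law \<nu>)" "depends_on \<nu> B v" and "finite B" "A \<inter> B = {}"
  shows "mean \<nu> (\<lambda>\<eta>. u \<eta> * v \<eta>) = mean \<nu> u * mean \<nu> v"
  using \<open>finite B\<close> v \<open>A \<inter> B = {}\<close>
proof (induction B arbitrary: v)
  case empty
  interpret mu: prob_space "product_law \<nu> :: ('d, 'x) config measure"
    by (rule prob_space_product_law)
  obtain \<omega> where \<omega>: "\<omega> \<in> space (product_law \<nu> :: ('d, 'x) config measure)"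
    using mu.not_empty by blast
  have *: "v \<eta> = v \<omega>" if "\<eta> \<in> space (product_law \<nu>)" for \<eta>
    using depends_onD[OF empty(2) that \<omega>] by simp
  have "mean \<nu> (\<lambda>\<eta>. u \<eta> * v \<eta>) = mean \<nu> (\<lambda>\<eta>. u \<eta> * v \<omega>)"
    unfolding mean_def using * by (intro Bochner_Integration.integral_cong) auto
  moreover have "mean \<nu> v = mean \<nu> (\<lambda>\<eta> :: ('d, 'x) config. v \<omega>)"
    unfolding mean_def by (rule Bochner_Integration.integral_cong[OF refl *])
  moreover have "mean \<nu> (\<lambda>\<eta> :: ('d, 'x) config. v \<omega>) = v \<omega>"
    by (simp add: mean_def mu.prob_space)
  ultimately show ?case by (simp add: mean_def)
next
  case (insert b B)
  interpret mu: prob_space "product_law \<nu> :: ('d, 'x) config measure"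
    by (rule prob_space_product_law)
  have dep: "depends_on \<nu> B (resample b v)"
    using depends_on_resample[OF insert.prems(2), of b] by (rule depends_on_mono) auto
  have "mean \<nu> (\<lambda>\<eta>. u \<eta> * v \<eta>) = mean \<nu> (\<lambda>\<eta>. u \<eta> * resample b v \<eta>)"
    using insert.prems
    by (intro mean_mult_resample[symmetric] u depends_on_mono[OF u(2)]) auto
  also have "\<dots> = mean \<nu> u * mean \<nu> (resample b v)"
    using insert.prems by (intro insert.IH dep resample_L2) auto
  also have "mean \<nu> (resample b v) = mean \<nu> v"
    by (intro resample_integrable mu.L2_integrable insert.prems)
  finally show ?case .
qed

end

section \<open>The lattice\<close>

lemma int_vec_generated_by_axes:
  fixes P :: "int ^ 'd::finite \<Rightarrow> bool"
  assumes gen: "\<And>\<alpha>. P (axis \<alpha> 1)" and add: "\<And>a b. P a \<Longrightarrow> P b \<Longrightarrow> P (a + b)"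
    and neg: "\<And>a. P a \<Longrightarrow> P (- a)"
  shows "P z"
proof -
  have zero: "P 0"
    using add[OF gen[of undefined] neg[OF gen[of undefined]]] by simp
  have mult: "P (axis \<alpha> k)" for \<alpha> k
  proof (induction k rule: int_induct[where k = 0])
    case base
    have "axis \<alpha> (0::int) = 0" by (simp add: vec_eq_iff axis_def)
    then show ?case by (subst \<open>axis \<alpha> 0 = 0\<close>) (rule zero)
  next
    case (step1 i)
    have "axis \<alpha> (i + 1) = axis \<alpha> i + axis \<alpha> 1" by (simp add: vec_eq_iff axis_def)
    then show ?case using step1 add gen by simp
  next
    case (step2 i)
    have "axis \<alpha> (i - 1) = axis \<alpha> i + - axis \<alpha> 1" by (simp add: vec_eq_iff axis_def)
    then show ?case using step2 add neg gen by metis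
  qed
  have "P (\<Sum>\<alpha>\<in>A. axis \<alpha> (z $ \<alpha>))" if "finite A" for A
    using that by induction (auto intro: zero add mult)
  moreover have "(\<Sum>\<alpha>\<in>UNIV. axis \<alpha> (z $ \<alpha>)) = z"
    by (simp add: vec_eq_iff axis_def sum_component)
  ultimately show ?thesis by (metis finite)
qed

text \<open>Take the inner product with a real vector \<open>v\<close> outside the hyperplanes orthogonal to the nonzero
  lattice vectors. There are countably many of these hyperplanes and each is negligible, so such
  a \<open>v\<close> exists.\<close>

lemma ex_injective_height:
  "\<exists>\<phi> :: int ^ 'd::finite \<Rightarrow> real. inj \<phi> \<and> (\<forall>x y. \<phi> (x - y) = \<phi> x - \<phi> y)"
proof -
  define R :: "int ^ 'd \<Rightarrow> real ^ 'd" where "R x = (\<chi> i. real_of_int (x $ i))" for x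
  have R_diff: "R (x - y) = R x - R y" for x y
    by (simp add: R_def vec_eq_iff)
  have R_nz: "R x \<noteq> 0" if "x \<noteq> 0" for x
    using that by (auto simp: R_def vec_eq_iff)
  have "negligible (\<Union>x\<in>UNIV - {0}. {v. R x \<bullet> v = 0})"
    by (rule negligible_countable_Union) (auto intro!: negligible_hyperplane R_nz)
  then have "(\<Union>x\<in>UNIV - {0}. {v. R x \<bullet> v = 0}) \<noteq> UNIV"
    using non_negligible_UNIV by metis
  then obtain v where v: "\<And>x. x \<noteq> 0 \<Longrightarrow> R x \<bullet> v \<noteq> 0"
    by blast
  have "inj (\<lambda>x. R x \<bullet> v)"
  proof (rule injI)
    fix x y assume "R x \<bullet> v = R y \<bullet> v"
    then have "R (x - y) \<bullet> v = 0" by (simp add: R_diff inner_diff_left)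
    then show "x = y" using v[of "x - y"] by auto
  qed
  then show ?thesis
    by (intro exI[of _ "\<lambda>x. R x \<bullet> v"]) (simp add: R_diff inner_diff_left)
qed

context
  fixes \<nu> :: "'x measure"
  assumes prob: "prob_space \<nu>"
begin

lemmas mu_L2_const = prob_space.L2_const[OF prob_space_product_law[OF prob]]
lemmas mu_L2_integrable = prob_space.L2_integrable[OF prob_space_product_law[OF prob]]

section \<open>Local functions and the shift form\<close>

lemma local_L2E:
  assumes "f \<in> local_L2 \<nu>"
  obtains h S where "finite S" "h \<in> L2 (product_law \<nu>)" "depends_on \<nu> S h"
    "AE \<eta> in product_law \<nu>. f \<eta> = h \<eta>"
  using assms L2_cong_AE unfolding local_L2_def local_fun_def depends_on_def by blast

lemma local_L2_cong_AE:
  assumes "h \<in> local_L2 \<nu>" "f \<in> L2 (product_law \<nu>)" "AE \<eta> in product_law \<nu>. f \<eta> = h \<eta>"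
  shows "f \<in> local_L2 \<nu>"
proof -
  obtain k where k: "k \<in> borel_measurable (product_law \<nu>)" "local_fun \<nu> k"
    "AE \<eta> in product_law \<nu>. h \<eta> = k \<eta>"
    using assms(1) by (auto simp: local_L2_def)
  from assms(3) k(3) have "AE \<eta> in product_law \<nu>. f \<eta> = k \<eta>"
    by eventually_elim simp
  with k assms(2) show ?thesis by (auto simp: local_L2_def)
qed

lemma local_L2I:
  "finite S \<Longrightarrow> h \<in> L2 (product_law \<nu>) \<Longrightarrow> depends_on \<nu> S h \<Longrightarrow> h \<in> local_L2 \<nu>"
  unfolding local_L2_def local_fun_def depends_on_def L2_def by blast

lemma local_L2_L2: "f \<in> local_L2 \<nu> \<Longrightarrow> f \<in> L2 (product_law \<nu>)"
  by (simp add: local_L2_def)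

lemma local_L2_add:
  assumes "f \<in> local_L2 \<nu>" "g \<in> local_L2 \<nu>"
  shows "(\<lambda>\<eta>. f \<eta> + g \<eta>) \<in> local_L2 \<nu>"
proof -
  from assms(1) obtain h S where h: "finite S" "h \<in> L2 (product_law \<nu>)" "depends_on \<nu> S h"
    "AE \<eta> in product_law \<nu>. f \<eta> = h \<eta>" by (rule local_L2E)
  from assms(2) obtain k T where k: "finite T" "k \<in> L2 (product_law \<nu>)" "depends_on \<nu> T k"
    "AE \<eta> in product_law \<nu>. g \<eta> = k \<eta>" by (rule local_L2E)
  have "(\<lambda>\<eta>. h \<eta> + k \<eta>) \<in> local_L2 \<nu>"
    using h k by (intro local_L2I[of "S \<union> T"] L2_add depends_on_add) auto
  then show ?thesis
  proof (rule local_L2_cong_AE)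
    show "(\<lambda>\<eta>. f \<eta> + g \<eta>) \<in> L2 (product_law \<nu>)"
      by (intro L2_add local_L2_L2 assms)
    show "AE \<eta> in product_law \<nu>. f \<eta> + g \<eta> = h \<eta> + k \<eta>"
      using h(4) k(4) by eventually_elim simp
  qed
qed

lemma local_L2_scale:
  assumes "f \<in> local_L2 \<nu>"
  shows "(\<lambda>\<eta>. c * f \<eta>) \<in> local_L2 \<nu>"
proof -
  from assms obtain h S where h: "finite S" "h \<in> L2 (product_law \<nu>)" "depends_on \<nu> S h"
    "AE \<eta> in product_law \<nu>. f \<eta> = h \<eta>" by (rule local_L2E)
  have "(\<lambda>\<eta>. c * h \<eta>) \<in> local_L2 \<nu>"
    using h by (intro local_L2I[of S] L2_scale depends_on_scale) auto
  then show ?thesis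
  proof (rule local_L2_cong_AE)
    show "(\<lambda>\<eta>. c * f \<eta>) \<in> L2 (product_law \<nu>)"
      by (intro L2_scale local_L2_L2 assms)
    show "AE \<eta> in product_law \<nu>. c * f \<eta> = c * h \<eta>"
      using h(4) by eventually_elim simp
  qed
qed

lemma local_L2_diff:
  "f \<in> local_L2 \<nu> \<Longrightarrow> g \<in> local_L2 \<nu> \<Longrightarrow> (\<lambda>\<eta>. f \<eta> - g \<eta>) \<in> local_L2 \<nu>"
  using local_L2_add[of f "\<lambda>\<eta>. (-1) * g \<eta>"] local_L2_scale[of g "-1"] by simp

lemma local_L2_const: "(\<lambda>_. c) \<in> local_L2 \<nu>"
  by (rule local_L2I[of "{}"]) (auto intro: mu_L2_const depends_on_const)

lemma local_L2_sum:
  "(\<And>i. i \<in> I \<Longrightarrow> f i \<in> local_L2 \<nu>) \<Longrightarrow> (\<lambda>\<eta>. \<Sum>i\<in>I. f i \<eta>) \<in> local_L2 \<nu>"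
  by (induction I rule: infinite_finite_induct) (auto intro: local_L2_add local_L2_const)

lemma local_L2_shift:
  assumes "f \<in> local_L2 \<nu>"
  shows "shift_fun z f \<in> local_L2 \<nu>"
proof -
  from assms obtain h S where h: "finite S" "h \<in> L2 (product_law \<nu>)" "depends_on \<nu> S h"
    "AE \<eta> in product_law \<nu>. f \<eta> = h \<eta>" by (rule local_L2E)
  have "shift_fun z h \<in> local_L2 \<nu>"
    using h by (intro local_L2I[OF _ _ depends_on_shift] shift_fun_L2 prob) auto
  then show ?thesis
    by (rule local_L2_cong_AE) (intro shift_fun_L2 AE_shift_fun local_L2_L2 assms prob h)+
qed

lemma mean_cong_AE:
  "f \<in> borel_measurable (product_law \<nu>) \<Longrightarrow> g \<in> borel_measurable (product_law \<nu>) \<Longrightarrow>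
    AE \<eta> in product_law \<nu>. f \<eta> = g \<eta> \<Longrightarrow> mean \<nu> f = mean \<nu> g"
  unfolding mean_def by (rule integral_cong_AE)

lemma mean_add:
  "f \<in> L2 (product_law \<nu>) \<Longrightarrow> g \<in> L2 (product_law \<nu>) \<Longrightarrow>
    mean \<nu> (\<lambda>\<eta>. f \<eta> + g \<eta>) = mean \<nu> f + mean \<nu> g"
  unfolding mean_def by (intro Bochner_Integration.integral_add mu_L2_integrable)

lemma mean_diff:
  "f \<in> L2 (product_law \<nu>) \<Longrightarrow> g \<in> L2 (product_law \<nu>) \<Longrightarrow>
    mean \<nu> (\<lambda>\<eta>. f \<eta> - g \<eta>) = mean \<nu> f - mean \<nu> g"
  unfolding mean_def by (intro Bochner_Integration.integral_diff mu_L2_integrable)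

lemma mean_const: "mean \<nu> (\<lambda>\<eta> :: ('d::finite, 'x) config. c) = c"
proof -
  interpret mu: prob_space "product_law \<nu> :: ('d, 'x) config measure"
    by (rule prob_space_product_law[OF prob])
  show ?thesis by (simp add: mean_def mu.prob_space)
qed

lemma mean_shift_mult:
  fixes f g :: "('d::finite, 'x) config \<Rightarrow> real"
  assumes "f \<in> L2 (product_law \<nu>)" "g \<in> L2 (product_law \<nu>)"
  shows "mean \<nu> (\<lambda>\<eta>. shift_fun x f \<eta> * g \<eta>) = mean \<nu> (\<lambda>\<eta>. f \<eta> * shift_fun (- x) g \<eta>)"
proof -
  have "(\<lambda>\<eta>. shift_fun x f \<eta> * g \<eta>) \<in> borel_measurable (product_law \<nu>)"
    using shift_fun_L2[OF prob assms(1), of x] assms(2) by (auto simp: L2_def)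
  from mean_shift[OF prob this, of "- x"] show ?thesis
    by (simp add: shift_fun_def shift_config_def)
qed

definition correlation where
  "correlation x f g = mean \<nu> (\<lambda>\<eta>. shift_fun x f \<eta> * g \<eta>) - mean \<nu> f * mean \<nu> g"

lemma shift_form_correlation: "shift_form \<nu> f g = (\<Sum>\<^sub>\<infinity>x. correlation x f g)"
  by (simp add: shift_form_def correlation_def)

lemma correlation_cong_AE:
  fixes f g h k :: "('d::finite, 'x) config \<Rightarrow> real"
  assumes "f \<in> L2 (product_law \<nu>)" "g \<in> L2 (product_law \<nu>)"
    "h \<in> L2 (product_law \<nu>)" "k \<in> L2 (product_law \<nu>)"
    and AE: "AE \<eta> in product_law \<nu>. f \<eta> = h \<eta>" "AE \<eta> in product_law \<nu>. g \<eta> = k \<eta>"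
  shows "correlation x f g = correlation x h k"
proof -
  have "AE \<eta> in product_law \<nu>. shift_fun x f \<eta> * g \<eta> = shift_fun x h \<eta> * k \<eta>"
    using AE_shift_fun[OF prob AE(1), of x] AE(2) by eventually_elim simp
  moreover have "shift_fun x f \<in> L2 (product_law \<nu>)" "shift_fun x h \<in> L2 (product_law \<nu>)"
    using assms by (auto intro: shift_fun_L2 prob)
  ultimately have "mean \<nu> (\<lambda>\<eta>. shift_fun x f \<eta> * g \<eta>) = mean \<nu> (\<lambda>\<eta>. shift_fun x h \<eta> * k \<eta>)"
    using assms by (intro mean_cong_AE borel_measurable_times) (auto simp: L2_def)
  moreover have "mean \<nu> f = mean \<nu> h" "mean \<nu> g = mean \<nu> k"
    using assms by (auto intro!: mean_cong_AE simp: L2_def)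
  ultimately show ?thesis by (simp add: correlation_def)
qed

lemma correlation_add:
  fixes f g h :: "('d::finite, 'x) config \<Rightarrow> real"
  assumes "f \<in> L2 (product_law \<nu>)" "g \<in> L2 (product_law \<nu>)" "h \<in> L2 (product_law \<nu>)"
  shows "correlation x (\<lambda>\<eta>. f \<eta> + g \<eta>) h = correlation x f h + correlation x g h"
proof -
  have "mean \<nu> (\<lambda>\<eta>. shift_fun x f \<eta> * h \<eta> + shift_fun x g \<eta> * h \<eta>)
      = mean \<nu> (\<lambda>\<eta>. shift_fun x f \<eta> * h \<eta>) + mean \<nu> (\<lambda>\<eta>. shift_fun x g \<eta> * h \<eta>)"
    unfolding mean_def
    by (intro Bochner_Integration.integral_add L2_mult_integrable shift_fun_L2 assms prob)
  then show ?thesis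
    using mean_add[OF assms(1,2)] by (simp add: correlation_def shift_fun_def algebra_simps)
qed

lemma correlation_scale: "correlation x (\<lambda>\<eta>. c * f \<eta>) h = c * correlation x f h"
  by (simp add: correlation_def shift_fun_def mean_def algebra_simps)

text \<open>If \<open>f\<close> and \<open>g\<close> depend on \<open>S\<close> and \<open>T\<close>, the shift of \<open>f\<close> by \<open>x\<close> depends on \<open>S - x\<close>, which meets \<open>T\<close> only
  if \<open>x\<close> is a difference of a site of \<open>S\<close> and a site of \<open>T\<close>. This finiteness is what makes the shift form
  additive.\<close>

lemma finite_correlation:
  fixes f g :: "('d::finite, 'x) config \<Rightarrow> real"
  assumes "f \<in> local_L2 \<nu>" "g \<in> local_L2 \<nu>"
  shows "finite {x. correlation x f g \<noteq> 0}"
proof -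
  from assms(1) obtain h S where h: "finite S" "h \<in> L2 (product_law \<nu>)" "depends_on \<nu> S h"
    "AE \<eta> in product_law \<nu>. f \<eta> = h \<eta>" by (rule local_L2E)
  from assms(2) obtain k T where k: "finite T" "k \<in> L2 (product_law \<nu>)" "depends_on \<nu> T k"
    "AE \<eta> in product_law \<nu>. g \<eta> = k \<eta>" by (rule local_L2E)
  have "correlation x f g = 0" if "x \<notin> (\<lambda>(s, t). s - t) ` (S \<times> T)" for x
  proof -
    have "(\<lambda>s. s - x) ` S \<inter> T = {}" using that by (force simp: image_iff)
    then have "mean \<nu> (\<lambda>\<eta>. shift_fun x h \<eta> * k \<eta>) = mean \<nu> (shift_fun x h) * mean \<nu> k"
      by (rule mean_mult_disjoint[OF prob shift_fun_L2[OF prob h(2)] depends_on_shift[OF h(3)]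
            k(2,3,1)])
    also have "mean \<nu> (shift_fun x h) = mean \<nu> h"
      using h(2) by (intro mean_shift prob) (simp add: L2_def)
    finally have "correlation x h k = 0" by (simp add: correlation_def)
    with correlation_cong_AE[OF local_L2_L2 local_L2_L2 h(2) k(2) h(4) k(4)] assms
    show ?thesis by simp
  qed
  then have "{x. correlation x f g \<noteq> 0} \<subseteq> (\<lambda>(s, t). s - t) ` (S \<times> T)" by blast
  then show ?thesis using h(1) k(1) by (auto intro: finite_subset)
qed

lemma correlation_summable:
  "f \<in> local_L2 \<nu> \<Longrightarrow> g \<in> local_L2 \<nu> \<Longrightarrow> (\<lambda>x. correlation x f g) summable_on UNIV"
  by (rule finite_nonzero_values_imp_summable_on) (simp add: finite_correlation)

lemma shift_form_cong_AE:
  "f \<in> L2 (product_law \<nu>) \<Longrightarrow> g \<in> L2 (product_law \<nu>) \<Longrightarrow> h \<in> L2 (product_law \<nu>) \<Longrightarrow>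
    k \<in> L2 (product_law \<nu>) \<Longrightarrow> AE \<eta> in product_law \<nu>. f \<eta> = h \<eta> \<Longrightarrow>
    AE \<eta> in product_law \<nu>. g \<eta> = k \<eta> \<Longrightarrow> shift_form \<nu> f g = shift_form \<nu> h k"
  unfolding shift_form_correlation by (intro infsum_cong correlation_cong_AE)

lemma shift_form_add:
  assumes "f \<in> local_L2 \<nu>" "g \<in> local_L2 \<nu>" "h \<in> local_L2 \<nu>"
  shows "shift_form \<nu> (\<lambda>\<eta>. f \<eta> + g \<eta>) h = shift_form \<nu> f h + shift_form \<nu> g h"
  using assms unfolding shift_form_correlation
  by (simp add: correlation_add local_L2_L2 infsum_add correlation_summable)

lemma shift_form_scale: "shift_form \<nu> (\<lambda>\<eta>. c * f \<eta>) h = c * shift_form \<nu> f h"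
  by (simp add: shift_form_correlation correlation_scale infsum_cmult_right')

lemma shift_form_sum:
  assumes "finite I" "\<And>i. i \<in> I \<Longrightarrow> f i \<in> local_L2 \<nu>" "h \<in> local_L2 \<nu>"
  shows "shift_form \<nu> (\<lambda>\<eta>. \<Sum>i\<in>I. f i \<eta>) h = (\<Sum>i\<in>I. shift_form \<nu> (f i) h)"
  using assms(1,2)
proof induction
  case empty
  show ?case using shift_form_scale[of 0 _ h] by simp
next
  case (insert i I)
  then show ?case
    using shift_form_add[of "f i" "\<lambda>\<eta>. \<Sum>i\<in>I. f i \<eta>", OF _ local_L2_sum assms(3)] by simp
qed

lemma shift_form_commute:
  assumes "f \<in> L2 (product_law \<nu>)" "g \<in> L2 (product_law \<nu>)"
  shows "shift_form \<nu> f g = shift_form \<nu> g f"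
proof -
  have "correlation x f g = correlation (- x) g f" for x
    using mean_shift_mult[OF assms, of x] by (simp add: correlation_def mult.commute)
  then show ?thesis
    unfolding shift_form_correlation
    by (simp add: infsum_reindex_bij_betw[of uminus UNIV UNIV "\<lambda>x. correlation x g f"]
        bij_uminus)
qed

lemma shift_form_shift:
  assumes "f \<in> L2 (product_law \<nu>)"
  shows "shift_form \<nu> (shift_fun z f) g = shift_form \<nu> f g"
proof -
  have "mean \<nu> (shift_fun z f) = mean \<nu> f"
    using assms by (intro mean_shift prob) (simp add: L2_def)
  then have "correlation x (shift_fun z f) g = correlation (x + z) f g" for x
    by (simp add: correlation_def shift_fun_shift_fun)
  moreover have "bij (\<lambda>x. x + z)" by (simp add: bij_plus_right)
  ultimately show ?thesis
    unfolding shift_form_correlation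
    by (simp add: infsum_reindex_bij_betw[of "\<lambda>x. x + z" UNIV UNIV "\<lambda>x. correlation x f g"])
qed

section \<open>The gradient space\<close>

lemma gradient_spaceI:
  assumes "f \<in> L2 (product_law \<nu>)" "\<And>\<alpha>. a \<alpha> \<in> local_L2 \<nu>"
    "AE \<eta> in product_law \<nu>. f \<eta> = (\<Sum>\<alpha>\<in>UNIV. shift_fun (axis \<alpha> 1) (a \<alpha>) \<eta> - a \<alpha> \<eta>)"
  shows "f \<in> gradient_space \<nu>"
  unfolding gradient_space_def using assms by (intro CollectI conjI exI[of _ a]) auto

lemma gradient_space_cong_AE:
  assumes "f \<in> gradient_space \<nu>" "g \<in> L2 (product_law \<nu>)" "AE \<eta> in product_law \<nu>. g \<eta> = f \<eta>"
  shows "g \<in> gradient_space \<nu>"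
proof -
  obtain a where a: "\<And>\<alpha>. a \<alpha> \<in> local_L2 \<nu>"
    and AE: "AE \<eta> in product_law \<nu>. f \<eta> = (\<Sum>\<alpha>\<in>UNIV. shift_fun (axis \<alpha> 1) (a \<alpha>) \<eta> - a \<alpha> \<eta>)"
    using assms(1) unfolding gradient_space_def by blast
  have "AE \<eta> in product_law \<nu>. g \<eta> = (\<Sum>\<alpha>\<in>UNIV. shift_fun (axis \<alpha> 1) (a \<alpha>) \<eta> - a \<alpha> \<eta>)"
    using assms(3) AE by eventually_elim simp
  with assms(2) a show ?thesis by (rule gradient_spaceI)
qed

lemma gradient_space_L2: "f \<in> gradient_space \<nu> \<Longrightarrow> f \<in> L2 (product_law \<nu>)"
  by (simp add: gradient_space_def)

lemma gradient_space_add: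
  assumes "f \<in> gradient_space \<nu>" "g \<in> gradient_space \<nu>"
  shows "(\<lambda>\<eta>. f \<eta> + g \<eta>) \<in> gradient_space \<nu>"
proof -
  obtain a where a: "\<And>\<alpha>. a \<alpha> \<in> local_L2 \<nu>"
    "AE \<eta> in product_law \<nu>. f \<eta> = (\<Sum>\<alpha>\<in>UNIV. shift_fun (axis \<alpha> 1) (a \<alpha>) \<eta> - a \<alpha> \<eta>)"
    using assms(1) unfolding gradient_space_def by blast
  obtain b where b: "\<And>\<alpha>. b \<alpha> \<in> local_L2 \<nu>"
    "AE \<eta> in product_law \<nu>. g \<eta> = (\<Sum>\<alpha>\<in>UNIV. shift_fun (axis \<alpha> 1) (b \<alpha>) \<eta> - b \<alpha> \<eta>)"
    using assms(2) unfolding gradient_space_def by blast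
  let ?c = "\<lambda>\<alpha> \<eta>. a \<alpha> \<eta> + b \<alpha> \<eta>"
  have "AE \<eta> in product_law \<nu>.
      f \<eta> + g \<eta> = (\<Sum>\<alpha>\<in>UNIV. shift_fun (axis \<alpha> 1) (?c \<alpha>) \<eta> - ?c \<alpha> \<eta>)"
    using a(2) b(2)
    by eventually_elim (simp add: shift_fun_def sum.distrib[symmetric] algebra_simps)
  from gradient_spaceI[OF L2_add[OF assms[THEN gradient_space_L2]] local_L2_add[OF a(1) b(1)] this]
  show ?thesis .
qed

lemma gradient_space_scale:
  assumes "f \<in> gradient_space \<nu>"
  shows "(\<lambda>\<eta>. c * f \<eta>) \<in> gradient_space \<nu>"
proof -
  obtain a where a: "\<And>\<alpha>. a \<alpha> \<in> local_L2 \<nu>"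
    "AE \<eta> in product_law \<nu>. f \<eta> = (\<Sum>\<alpha>\<in>UNIV. shift_fun (axis \<alpha> 1) (a \<alpha>) \<eta> - a \<alpha> \<eta>)"
    using assms unfolding gradient_space_def by blast
  let ?c = "\<lambda>\<alpha> \<eta>. c * a \<alpha> \<eta>"
  have "AE \<eta> in product_law \<nu>. c * f \<eta> = (\<Sum>\<alpha>\<in>UNIV. shift_fun (axis \<alpha> 1) (?c \<alpha>) \<eta> - ?c \<alpha> \<eta>)"
    using a(2) by eventually_elim (simp add: shift_fun_def sum_distrib_left algebra_simps)
  from gradient_spaceI[OF L2_scale[OF assms[THEN gradient_space_L2]] local_L2_scale[OF a(1)] this]
  show ?thesis .
qed

text \<open>A path from \<open>0\<close> to \<open>z\<close> in unit steps telescopes: \<open>\<tau>\<^sub>a\<^sub>+\<^sub>b f - f\<close> is the sum of \<open>\<tau>\<^sub>a f' - f'\<close> for \<open>f' = \<tau>\<^sub>b f\<close> and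
  of \<open>\<tau>\<^sub>b f - f\<close>, and a step backwards is the negative of a step forwards from the translated function.\<close>

lemma shift_diff_in_gradient_space:
  fixes f :: "('d::finite, 'x) config \<Rightarrow> real"
  assumes "f \<in> local_L2 \<nu>"
  shows "(\<lambda>\<eta>. shift_fun z f \<eta> - f \<eta>) \<in> gradient_space \<nu>"
proof -
  have "\<forall>f :: ('d, 'x) config \<Rightarrow> real. f \<in> local_L2 \<nu> \<longrightarrow>
      (\<lambda>\<eta>. shift_fun z f \<eta> - f \<eta>) \<in> gradient_space \<nu>"
  proof (rule int_vec_generated_by_axes[of _ z]; intro allI impI)
    fix \<alpha> :: 'd and f :: "('d, 'x) config \<Rightarrow> real" assume f: "f \<in> local_L2 \<nu>"
    define a where "a \<beta> = (if \<beta> = \<alpha> then f else (\<lambda>_. 0))" for \<beta>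
    have "(\<Sum>\<beta>\<in>UNIV. shift_fun (axis \<beta> 1) (a \<beta>) \<eta> - a \<beta> \<eta>)
        = (\<Sum>\<beta>\<in>UNIV. if \<beta> = \<alpha> then shift_fun (axis \<alpha> 1) f \<eta> - f \<eta> else 0)" for \<eta>
      by (intro sum.cong) (auto simp: a_def shift_fun_def)
    then have "AE \<eta> in product_law \<nu>. shift_fun (axis \<alpha> 1) f \<eta> - f \<eta>
        = (\<Sum>\<beta>\<in>UNIV. shift_fun (axis \<beta> 1) (a \<beta>) \<eta> - a \<beta> \<eta>)"
      by simp
    moreover have "a \<beta> \<in> local_L2 \<nu>" for \<beta> using f by (simp add: a_def local_L2_const)
    moreover have "(\<lambda>\<eta>. shift_fun (axis \<alpha> 1) f \<eta> - f \<eta>) \<in> L2 (product_law \<nu>)"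
      using f by (intro local_L2_L2 local_L2_diff local_L2_shift)
    ultimately show "(\<lambda>\<eta>. shift_fun (axis \<alpha> 1) f \<eta> - f \<eta>) \<in> gradient_space \<nu>"
      by (intro gradient_spaceI[where a = a])
  next
    fix a b :: "int ^ 'd" and f :: "('d, 'x) config \<Rightarrow> real"
    assume IH: "\<forall>f :: ('d, 'x) config \<Rightarrow> real. f \<in> local_L2 \<nu> \<longrightarrow>
        (\<lambda>\<eta>. shift_fun a f \<eta> - f \<eta>) \<in> gradient_space \<nu>"
      "\<forall>f :: ('d, 'x) config \<Rightarrow> real. f \<in> local_L2 \<nu> \<longrightarrow>
        (\<lambda>\<eta>. shift_fun b f \<eta> - f \<eta>) \<in> gradient_space \<nu>"
      and f: "f \<in> local_L2 \<nu>"
    have "(\<lambda>\<eta>. (shift_fun a (shift_fun b f) \<eta> - shift_fun b f \<eta>) + (shift_fun b f \<eta> - f \<eta>))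
        \<in> gradient_space \<nu>"
      using IH f local_L2_shift[OF f, of b] by (intro gradient_space_add) auto
    then show "(\<lambda>\<eta>. shift_fun (a + b) f \<eta> - f \<eta>) \<in> gradient_space \<nu>"
      by (simp add: shift_fun_shift_fun)
  next
    fix a :: "int ^ 'd" and f :: "('d, 'x) config \<Rightarrow> real"
    assume IH: "\<forall>f :: ('d, 'x) config \<Rightarrow> real. f \<in> local_L2 \<nu> \<longrightarrow>
        (\<lambda>\<eta>. shift_fun a f \<eta> - f \<eta>) \<in> gradient_space \<nu>" and f: "f \<in> local_L2 \<nu>"
    have "(\<lambda>\<eta>. (-1) * (shift_fun a (shift_fun (- a) f) \<eta> - shift_fun (- a) f \<eta>))
        \<in> gradient_space \<nu>"
      using IH local_L2_shift[OF f, of "- a"] by (intro gradient_space_scale) auto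
    then show "(\<lambda>\<eta>. shift_fun (- a) f \<eta> - f \<eta>) \<in> gradient_space \<nu>"
      by (simp add: shift_fun_shift_fun shift_fun_0)
  qed
  with assms show ?thesis by blast
qed

lemma gradient_space_zero: "(\<lambda>_. 0) \<in> gradient_space \<nu>"
  using shift_diff_in_gradient_space[OF local_L2_const, of 0 0] by (simp add: shift_fun_0)

lemma gradient_space_properties:
  fixes k :: "('d::finite, 'x) config \<Rightarrow> real"
  assumes "k \<in> gradient_space \<nu>"
  shows "k \<in> local_L2 \<nu>" "mean \<nu> k = 0" "h \<in> local_L2 \<nu> \<Longrightarrow> shift_form \<nu> k h = 0"
proof -
  obtain a where a: "\<And>\<alpha>. a \<alpha> \<in> local_L2 \<nu>"
    and AE: "AE \<eta> in product_law \<nu>. k \<eta> = (\<Sum>\<alpha>\<in>UNIV. shift_fun (axis \<alpha> 1) (a \<alpha>) \<eta> - a \<alpha> \<eta>)"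
    using assms unfolding gradient_space_def by blast
  let ?d = "\<lambda>\<alpha> \<eta>. shift_fun (axis \<alpha> 1) (a \<alpha>) \<eta> - a \<alpha> \<eta>"
  have L2k: "k \<in> L2 (product_law \<nu>)" by (rule gradient_space_L2[OF assms])
  have d: "?d \<alpha> \<in> local_L2 \<nu>" for \<alpha> by (intro local_L2_diff local_L2_shift a)
  then have sum: "(\<lambda>\<eta>. \<Sum>\<alpha>\<in>UNIV. ?d \<alpha> \<eta>) \<in> local_L2 \<nu>" by (intro local_L2_sum)
  then show "k \<in> local_L2 \<nu>" by (rule local_L2_cong_AE[OF _ L2k AE])
  have mean_d: "mean \<nu> (?d \<alpha>) = 0" for \<alpha>
    using mean_shift[OF prob, of "a \<alpha>" "axis \<alpha> 1"] local_L2_L2[OF a[of \<alpha>]]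
      mean_diff[OF shift_fun_L2[OF prob local_L2_L2[OF a]] local_L2_L2[OF a], of "axis \<alpha> 1" \<alpha> \<alpha>]
    by (simp add: L2_def)
  have "mean \<nu> k = mean \<nu> (\<lambda>\<eta>. \<Sum>\<alpha>\<in>UNIV. ?d \<alpha> \<eta>)"
    using L2k local_L2_L2[OF sum] by (intro mean_cong_AE AE) (auto simp: L2_def)
  also have "\<dots> = (\<Sum>\<alpha>\<in>UNIV. mean \<nu> (?d \<alpha>))"
    unfolding mean_def by (intro Bochner_Integration.integral_sum mu_L2_integrable local_L2_L2 d)
  finally show "mean \<nu> k = 0" by (simp add: mean_d)
  assume h: "h \<in> local_L2 \<nu>"
  have "shift_form \<nu> k h = shift_form \<nu> (\<lambda>\<eta>. \<Sum>\<alpha>\<in>UNIV. ?d \<alpha> \<eta>) h"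
    by (intro shift_form_cong_AE L2k local_L2_L2 sum h AE) simp
  also have "\<dots> = (\<Sum>\<alpha>\<in>UNIV. shift_form \<nu> (?d \<alpha>) h)"
    by (intro shift_form_sum d h) simp
  also have "\<dots> = 0"
  proof (rule sum.neutral, rule ballI)
    fix \<alpha>
    have "shift_form \<nu> (\<lambda>\<eta>. ?d \<alpha> \<eta> + a \<alpha> \<eta>) h = shift_form \<nu> (?d \<alpha>) h + shift_form \<nu> (a \<alpha>) h"
      by (intro shift_form_add d a h)
    then show "shift_form \<nu> (?d \<alpha>) h = 0"
      using shift_form_shift[OF local_L2_L2[OF a[of \<alpha>]], of "axis \<alpha> 1" h] by simp
  qed
  finally show "shift_form \<nu> k h = 0" .
qed

lemma constant_space_local: "c \<in> constant_space \<nu> \<Longrightarrow> c \<in> local_L2 \<nu>"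
  using local_L2_cong_AE[OF local_L2_const] unfolding constant_space_def by blast

lemma shift_form_constant:
  fixes c h :: "('d::finite, 'x) config \<Rightarrow> real"
  assumes "c \<in> constant_space \<nu>" "h \<in> local_L2 \<nu>"
  shows "shift_form \<nu> c h = 0"
proof -
  obtain r where r: "c \<in> L2 (product_law \<nu>)" "AE \<eta> in product_law \<nu>. c \<eta> = r"
    using assms(1) unfolding constant_space_def by blast
  have "shift_form \<nu> c h = shift_form \<nu> (\<lambda>_. r) h"
    using r by (intro shift_form_cong_AE local_L2_L2[OF assms(2)] mu_L2_const) auto
  also have "correlation x (\<lambda>_. r) h = 0" for x
    by (simp add: correlation_def shift_fun_def mean_const) (simp add: mean_def)
  then have "shift_form \<nu> (\<lambda>_. r) h = 0"
    by (simp add: shift_form_correlation)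
  finally show ?thesis .
qed

text \<open>Symmetry of the form turns a null vector on the left into a null vector on both sides.\<close>

lemma shift_form_add_null:
  assumes g: "g \<in> local_L2 \<nu>" and n: "n \<in> local_L2 \<nu>"
    and null: "\<And>h. h \<in> local_L2 \<nu> \<Longrightarrow> shift_form \<nu> n h = 0"
  shows "shift_form \<nu> (\<lambda>\<eta>. g \<eta> + n \<eta>) (\<lambda>\<eta>. g \<eta> + n \<eta>) = shift_form \<nu> g g"
proof -
  let ?s = "\<lambda>\<eta>. g \<eta> + n \<eta>"
  have s: "?s \<in> local_L2 \<nu>" by (intro local_L2_add g n)
  have "shift_form \<nu> ?s ?s = shift_form \<nu> g ?s"
    using shift_form_add[OF g n s] null[OF s] by simp
  also have "\<dots> = shift_form \<nu> ?s g"
    by (intro shift_form_commute local_L2_L2 g s)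
  also have "\<dots> = shift_form \<nu> g g"
    using shift_form_add[OF g n g] null[OF g] by simp
  finally show ?thesis .
qed

section \<open>Innovations\<close>

text \<open>The last condition says that the conditional mean of \<open>g\<close> given all the coordinates other than the one at
  the origin is zero. It is stated as an orthogonality relation, so that innovations are visibly
  closed under sums.\<close>

definition innovation ::
  "(int ^ 'd \<Rightarrow> real) \<Rightarrow> (('d::finite, 'x) config \<Rightarrow> real) \<Rightarrow> bool" where
  "innovation \<phi> g \<longleftrightarrow> g \<in> L2 (product_law \<nu>) \<and>
     (\<exists>T. finite T \<and> (\<forall>x\<in>T. \<phi> x \<le> 0) \<and> depends_on \<nu> T g) \<and>
     (\<forall>u \<in> L2 (product_law \<nu>). depends_on \<nu> (- {0}) u \<longrightarrow> mean \<nu> (\<lambda>\<eta>. u \<eta> * g \<eta>) = 0)"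

lemma innovation_local_L2: "innovation \<phi> g \<Longrightarrow> g \<in> local_L2 \<nu>"
  unfolding innovation_def by (auto intro: local_L2I)

lemma innovation_zero: "innovation \<phi> (\<lambda>_. 0)"
  unfolding innovation_def
  by (auto intro!: L2_zero exI[of _ "{}"] depends_on_const simp: mean_def)

lemma innovation_add:
  fixes f g :: "('d::finite, 'x) config \<Rightarrow> real"
  assumes "innovation \<phi> f" "innovation \<phi> g"
  shows "innovation \<phi> (\<lambda>\<eta>. f \<eta> + g \<eta>)"
proof -
  obtain S T where S: "finite S" "\<forall>x\<in>S. \<phi> x \<le> 0" "depends_on \<nu> S f"
    and T: "finite T" "\<forall>x\<in>T. \<phi> x \<le> 0" "depends_on \<nu> T g"
    using assms unfolding innovation_def by blast
  have L2: "f \<in> L2 (product_law \<nu>)" "g \<in> L2 (product_law \<nu>)"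
    using assms unfolding innovation_def by blast+
  have "mean \<nu> (\<lambda>\<eta>. u \<eta> * (f \<eta> + g \<eta>)) = 0"
    if u: "u \<in> L2 (product_law \<nu>)" "depends_on \<nu> (- {0}) u" for u
  proof -
    have "mean \<nu> (\<lambda>\<eta>. u \<eta> * (f \<eta> + g \<eta>)) = mean \<nu> (\<lambda>\<eta>. u \<eta> * f \<eta>) + mean \<nu> (\<lambda>\<eta>. u \<eta> * g \<eta>)"
      using L2_mult_integrable[OF u(1) L2(1)] L2_mult_integrable[OF u(1) L2(2)]
      by (simp add: mean_def distrib_left)
    then show ?thesis using assms u unfolding innovation_def by simp
  qed
  moreover have "\<exists>U. finite U \<and> (\<forall>x\<in>U. \<phi> x \<le> 0) \<and> depends_on \<nu> U (\<lambda>\<eta>. f \<eta> + g \<eta>)"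
    using S T by (intro exI[of _ "S \<union> T"]) (auto intro: depends_on_add)
  ultimately show ?thesis
    unfolding innovation_def using L2_add[OF L2] by blast
qed

text \<open>Removing from \<open>h\<close> its average over the highest site \<open>m\<close> leaves a function of conditional mean
  zero at \<open>m\<close>; the shift by \<open>m\<close> takes \<open>m\<close> to the origin and the rest of \<open>T\<close> to heights at most \<open>0\<close>.\<close>

lemma innovation_shifted_increment:
  fixes h :: "('d::finite, 'x) config \<Rightarrow> real"
  assumes \<phi>: "\<And>x y. \<phi> (x - y) = \<phi> x - \<phi> y"
    and h: "h \<in> L2 (product_law \<nu>)" "depends_on \<nu> T h" "finite T"
    and m: "\<And>x. x \<in> T \<Longrightarrow> \<phi> x \<le> \<phi> m"
  shows "innovation \<phi> (shift_fun m (\<lambda>\<eta>. h \<eta> - resample \<nu> m h \<eta>))" (is "innovation \<phi> (shift_fun m ?d)")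
proof -
  have r: "resample \<nu> m h \<in> L2 (product_law \<nu>)" by (intro resample_L2 prob h)
  have d: "?d \<in> L2 (product_law \<nu>)" by (intro L2_diff r h)
  have "depends_on \<nu> T (resample \<nu> m h)"
    using depends_on_resample[OF prob h(2)] by (rule depends_on_mono) auto
  then have "depends_on \<nu> T ?d"
    by (intro depends_on_diff h)
  then have "depends_on \<nu> ((\<lambda>x. x - m) ` T) (shift_fun m ?d)"
    by (rule depends_on_shift)
  moreover have "\<forall>x \<in> (\<lambda>x. x - m) ` T. \<phi> x \<le> 0"
    using m by (auto simp: \<phi>)
  moreover have "mean \<nu> (\<lambda>\<eta>. u \<eta> * shift_fun m ?d \<eta>) = 0"
    if u: "u \<in> L2 (product_law \<nu>)" "depends_on \<nu> (- {0}) u" for u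
  proof -
    let ?u = "shift_fun (- m) u"
    have u': "?u \<in> L2 (product_law \<nu>)" by (intro shift_fun_L2 prob u)
    have dep: "depends_on \<nu> (- {m}) ?u"
      using depends_on_shift[OF u(2), of "- m"] by (rule depends_on_mono) auto
    have "mean \<nu> (\<lambda>\<eta>. u \<eta> * shift_fun m ?d \<eta>) = mean \<nu> (\<lambda>\<eta>. ?u \<eta> * ?d \<eta>)"
      using mean_shift_mult[OF d u(1), of m] by (simp add: mult.commute)
    also have "\<dots> = mean \<nu> (\<lambda>\<eta>. ?u \<eta> * h \<eta>) - mean \<nu> (\<lambda>\<eta>. ?u \<eta> * resample \<nu> m h \<eta>)"
      using L2_mult_integrable[OF u' h(1)] L2_mult_integrable[OF u' r]
      by (simp add: mean_def right_diff_distrib)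
    also have "\<dots> = 0"
      using mean_mult_resample[OF prob u' h(1) dep] by simp
    finally show ?thesis .
  qed
  ultimately show ?thesis
    unfolding innovation_def using shift_fun_L2[OF prob d, of m] h(3) by blast
qed

text \<open>Induction over the sites in order of increasing height: the average over the highest site \<open>m\<close> is covered by the
  induction hypothesis, and the increment at \<open>m\<close> is replaced by its translate to the origin, at the
  price of a gradient. A function of no site at all is its own mean.\<close>

lemma decompose_innovation_gradient:
  fixes h :: "('d::finite, 'x) config \<Rightarrow> real"
  assumes \<phi>: "\<And>x y. \<phi> (x - y) = \<phi> x - \<phi> y"
    and "finite T" "h \<in> L2 (product_law \<nu>)" "depends_on \<nu> T h"
  shows "\<exists>g. innovation \<phi> g \<and> (\<lambda>\<eta>. h \<eta> - mean \<nu> h - g \<eta>) \<in> gradient_space \<nu>"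
  using assms(2-4)
proof (induction T arbitrary: h rule: finite_ranking_induct[where f = \<phi>])
  case empty
  interpret mu: prob_space "product_law \<nu> :: ('d, 'x) config measure"
    by (rule prob_space_product_law[OF prob])
  obtain \<omega> where \<omega>: "\<omega> \<in> space (product_law \<nu> :: ('d, 'x) config measure)"
    using mu.not_empty by blast
  have *: "h \<eta> = h \<omega>" if "\<eta> \<in> space (product_law \<nu>)" for \<eta>
    using depends_onD[OF empty(2) that \<omega>] by simp
  have "mean \<nu> h = mean \<nu> (\<lambda>\<eta> :: ('d, 'x) config. h \<omega>)"
    unfolding mean_def by (rule Bochner_Integration.integral_cong[OF refl *])
  then have "AE \<eta> in product_law \<nu>. h \<eta> - mean \<nu> h - 0 = 0"
    using * by (auto simp: mean_const)
  then have "(\<lambda>\<eta>. h \<eta> - mean \<nu> h - 0) \<in> gradient_space \<nu>"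
    by (intro gradient_space_cong_AE[OF gradient_space_zero] L2_diff empty mu_L2_const)
  then show ?case using innovation_zero by blast
next
  case (insert m T)
  let ?r = "resample \<nu> m h"
  let ?d = "\<lambda>\<eta>. h \<eta> - ?r \<eta>"
  have r: "?r \<in> L2 (product_law \<nu>)" "depends_on \<nu> T ?r"
    using depends_on_resample[OF prob insert.prems(2), of m] insert.prems
    by (auto intro: resample_L2 prob depends_on_mono)
  from insert.IH[OF r] obtain g where g: "innovation \<phi> g"
    and grad: "(\<lambda>\<eta>. ?r \<eta> - mean \<nu> ?r - g \<eta>) \<in> gradient_space \<nu>" by blast
  have mean: "mean \<nu> ?r = mean \<nu> h"
    by (intro resample_integrable prob mu_L2_integrable insert.prems)
  have d: "?d \<in> local_L2 \<nu>"
    using insert.hyps insert.prems r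
    by (intro local_L2_diff local_L2I[of "insert m T"]) (auto intro: depends_on_mono)
  have "(\<lambda>\<eta>. (?r \<eta> - mean \<nu> ?r - g \<eta>) + (-1) * (shift_fun m ?d \<eta> - ?d \<eta>)) \<in> gradient_space \<nu>"
    by (intro gradient_space_add gradient_space_scale grad shift_diff_in_gradient_space d)
  then have "(\<lambda>\<eta>. h \<eta> - mean \<nu> h - (g \<eta> + shift_fun m ?d \<eta>)) \<in> gradient_space \<nu>"
    by (simp add: mean algebra_simps)
  moreover have "innovation \<phi> (\<lambda>\<eta>. g \<eta> + shift_fun m ?d \<eta>)"
    using insert.hyps insert.prems
    by (intro innovation_add g innovation_shifted_increment[where T = "insert m T"] \<phi>) auto
  ultimately show ?case by blast
qed

text \<open>If \<open>\<phi> x > 0\<close>, then \<open>x\<close> is too high to be a site of \<open>g\<close>, so the shift of \<open>g\<close> by \<open>x\<close> does not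
  depend on the origin and is orthogonal to \<open>g\<close>. Moving the shift to the other factor gives the case \<open>\<phi> x < 0\<close>,
  and injectivity leaves only \<open>x = 0\<close>.\<close>

lemma shift_form_innovation:
  fixes g :: "('d::finite, 'x) config \<Rightarrow> real"
  assumes \<phi>: "\<And>x y. \<phi> (x - y) = \<phi> x - \<phi> y" and "inj \<phi>" and g: "innovation \<phi> g"
  shows "shift_form \<nu> g g = mean \<nu> (\<lambda>\<eta>. (g \<eta>)\<^sup>2)"
proof -
  obtain T where T: "\<And>x. x \<in> T \<Longrightarrow> \<phi> x \<le> 0" "depends_on \<nu> T g"
    using g unfolding innovation_def by blast
  have L2: "g \<in> L2 (product_law \<nu>)"
    and orth: "\<And>u. u \<in> L2 (product_law \<nu>) \<Longrightarrow> depends_on \<nu> (- {0}) u \<Longrightarrow>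
      mean \<nu> (\<lambda>\<eta>. u \<eta> * g \<eta>) = 0"
    using g unfolding innovation_def by blast+
  have "mean \<nu> g = 0"
    using orth[of "\<lambda>_. 1"] by (simp add: mu_L2_const depends_on_const)
  have \<phi>0: "\<phi> 0 = 0" using \<phi>[of 0 0] by simp
  have pos: "mean \<nu> (\<lambda>\<eta>. shift_fun x g \<eta> * g \<eta>) = 0" if "\<phi> x > 0" for x
  proof (rule orth)
    show "shift_fun x g \<in> L2 (product_law \<nu>)" by (intro shift_fun_L2 prob L2)
    have "x \<notin> T" using T(1)[of x] that by auto
    then show "depends_on \<nu> (- {0}) (shift_fun x g)"
      by (intro depends_on_mono[OF depends_on_shift[OF T(2)]]) auto
  qed
  have "correlation x g g = 0" if "x \<noteq> 0" for x
  proof -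
    have "\<phi> x \<noteq> 0" using that injD[OF \<open>inj \<phi>\<close>, of x 0] \<phi>0 by auto
    then consider "\<phi> x > 0" | "\<phi> (- x) > 0" using \<phi>[of 0 x] \<phi>0 by force
    then have "mean \<nu> (\<lambda>\<eta>. shift_fun x g \<eta> * g \<eta>) = 0"
    proof cases
      case 2
      then show ?thesis
        using pos[of "- x"] mean_shift_mult[OF L2 L2, of x] by (simp add: mult.commute)
    qed (rule pos)
    then show ?thesis by (simp add: correlation_def \<open>mean \<nu> g = 0\<close>)
  qed
  then have "shift_form \<nu> g g = (\<Sum>\<^sub>\<infinity>x\<in>{0}. correlation x g g)"
    unfolding shift_form_correlation by (intro infsum_cong_neutral) auto
  then show ?thesis
    by (simp add: correlation_def \<open>mean \<nu> g = 0\<close> shift_fun_0 power2_eq_square)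
qed

text \<open>Constants and gradients do not change the form, so its value at \<open>f\<close> is the second moment of the
  innovation part \<open>g\<close> of \<open>f\<close>. If that is zero, only the mean and the gradient remain.\<close>

lemma shift_form_kernel:
  fixes f :: "('d::finite, 'x) config \<Rightarrow> real"
  assumes f: "f \<in> local_L2 \<nu>" and ker: "shift_form \<nu> f f = 0"
  shows "(\<lambda>\<eta>. f \<eta> - mean \<nu> f) \<in> gradient_space \<nu>"
proof -
  obtain \<phi> :: "int ^ 'd \<Rightarrow> real" where "inj \<phi>" and \<phi>: "\<And>x y. \<phi> (x - y) = \<phi> x - \<phi> y"
    using ex_injective_height by blast
  from f obtain h T where h: "finite T" "h \<in> L2 (product_law \<nu>)" "depends_on \<nu> T h"
    and AE: "AE \<eta> in product_law \<nu>. f \<eta> = h \<eta>" by (rule local_L2E)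
  obtain g where g: "innovation \<phi> g"
    and "(\<lambda>\<eta>. h \<eta> - mean \<nu> h - g \<eta>) \<in> gradient_space \<nu>"
    using decompose_innovation_gradient[OF \<phi> h] by blast
  then obtain k where grad: "k \<in> gradient_space \<nu>" and k: "\<And>\<eta>. k \<eta> = h \<eta> - mean \<nu> h - g \<eta>"
    by blast
  have gl: "g \<in> local_L2 \<nu>" by (rule innovation_local_L2[OF g])
  have kl: "k \<in> local_L2 \<nu>" by (rule gradient_space_properties[OF grad])
  have const: "(\<lambda>_. mean \<nu> h) \<in> constant_space \<nu>"
    using mu_L2_const by (auto simp: constant_space_def)
  let ?n = "\<lambda>\<eta>. mean \<nu> h + k \<eta>"
  have nl: "?n \<in> local_L2 \<nu>" by (rule local_L2_add[OF local_L2_const kl])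
  have null: "shift_form \<nu> ?n w = 0" if "w \<in> local_L2 \<nu>" for w
    using shift_form_add[OF local_L2_const kl that] shift_form_constant[OF const that]
      gradient_space_properties(3)[OF grad that] by simp
  have "shift_form \<nu> f f = shift_form \<nu> h h"
    by (intro shift_form_cong_AE local_L2_L2 f h AE)
  also have "\<dots> = shift_form \<nu> g g"
    using shift_form_add_null[OF gl nl null] by (simp add: k)
  also have "\<dots> = mean \<nu> (\<lambda>\<eta>. (g \<eta>)\<^sup>2)"
    by (rule shift_form_innovation[OF \<phi> \<open>inj \<phi>\<close> g])
  finally have "(\<integral>\<eta>. (g \<eta>)\<^sup>2 \<partial>product_law \<nu>) = 0"
    using ker by (simp add: mean_def)
  moreover have "integrable (product_law \<nu>) (\<lambda>\<eta>. (g \<eta>)\<^sup>2)"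
    using local_L2_L2[OF gl] by (simp add: L2_def)
  ultimately have "AE \<eta> in product_law \<nu>. g \<eta> = 0"
    by (subst (asm) integral_nonneg_eq_0_iff_AE) auto
  moreover have "mean \<nu> f = mean \<nu> h"
    using local_L2_L2[OF f] h(2) by (intro mean_cong_AE AE) (auto simp: L2_def)
  ultimately have "AE \<eta> in product_law \<nu>. f \<eta> - mean \<nu> f = k \<eta>"
    using AE by (auto simp: k)
  then show ?thesis
    by (intro gradient_space_cong_AE[OF grad] L2_diff local_L2_L2[OF f] mu_L2_const)
qed

end

theorem theorem1:
  fixes \<nu> :: "'x measure"
  assumes "prob_space \<nu>" and "L2_separable \<nu>"
  shows "(\<forall>f \<in> (local_L2 \<nu> :: (('d::finite, 'x) config \<Rightarrow> real) set).
            mean \<nu> f = 0 \<and> shift_form \<nu> f f = 0 \<longrightarrow> f \<in> gradient_space \<nu>) \<and>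
         {f \<in> (local_L2 \<nu> :: (('d, 'x) config \<Rightarrow> real) set). shift_form \<nu> f f = 0} =
           {(\<lambda>\<eta>. c \<eta> + g \<eta>) | c g. c \<in> constant_space \<nu> \<and> g \<in> gradient_space \<nu>} \<and>
         (constant_space \<nu> :: (('d, 'x) config \<Rightarrow> real) set) \<inter> gradient_space \<nu> = null_space \<nu>"
proof (intro conjI)
  note prob = \<open>prob_space \<nu>\<close>
  show "\<forall>f \<in> (local_L2 \<nu> :: (('d, 'x) config \<Rightarrow> real) set).
      mean \<nu> f = 0 \<and> shift_form \<nu> f f = 0 \<longrightarrow> f \<in> gradient_space \<nu>"
  proof (intro ballI impI)
    fix f :: "('d, 'x) config \<Rightarrow> real"
    assume "f \<in> local_L2 \<nu>" "mean \<nu> f = 0 \<and> shift_form \<nu> f f = 0"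
    then show "f \<in> gradient_space \<nu>" using shift_form_kernel[OF prob, of f] by simp
  qed
  show "{f \<in> (local_L2 \<nu> :: (('d, 'x) config \<Rightarrow> real) set). shift_form \<nu> f f = 0} =
      {(\<lambda>\<eta>. c \<eta> + g \<eta>) | c g. c \<in> constant_space \<nu> \<and> g \<in> gradient_space \<nu>}" (is "?K = ?S")
  proof (intro subset_antisym subsetI)
    fix f :: "('d, 'x) config \<Rightarrow> real" assume "f \<in> ?K"
    then have "(\<lambda>\<eta>. f \<eta> - mean \<nu> f) \<in> gradient_space \<nu>"
      using shift_form_kernel[OF prob, of f] by simp
    moreover have "(\<lambda>_. mean \<nu> f) \<in> constant_space \<nu>"
      using mu_L2_const[OF prob] by (auto simp: constant_space_def)
    ultimately show "f \<in> ?S"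
      by (intro CollectI exI[of _ "\<lambda>_. mean \<nu> f"] exI[of _ "\<lambda>\<eta>. f \<eta> - mean \<nu> f"]) simp
  next
    fix f :: "('d, 'x) config \<Rightarrow> real" assume "f \<in> ?S"
    then obtain c g where f: "f = (\<lambda>\<eta>. c \<eta> + g \<eta>)"
      and c: "c \<in> constant_space \<nu>" and g: "g \<in> gradient_space \<nu>" by blast
    have cl: "c \<in> local_L2 \<nu>" by (rule constant_space_local[OF prob c])
    have gl: "g \<in> local_L2 \<nu>" by (rule gradient_space_properties[OF prob g])
    have fl: "f \<in> local_L2 \<nu>" unfolding f by (rule local_L2_add[OF prob cl gl])
    have "shift_form \<nu> f f = shift_form \<nu> c f + shift_form \<nu> g f"
      using shift_form_add[OF prob cl gl fl] by (simp add: f)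
    also have "\<dots> = 0"
      using shift_form_constant[OF prob c fl] gradient_space_properties(3)[OF prob g fl] by simp
    finally show "f \<in> ?K" using fl by simp
  qed
  show "(constant_space \<nu> :: (('d, 'x) config \<Rightarrow> real) set) \<inter> gradient_space \<nu> = null_space \<nu>"
  proof (intro subset_antisym subsetI)
    fix f :: "('d, 'x) config \<Rightarrow> real" assume f: "f \<in> constant_space \<nu> \<inter> gradient_space \<nu>"
    then obtain c where L2: "f \<in> L2 (product_law \<nu>)" and c: "AE \<eta> in product_law \<nu>. f \<eta> = c"
      unfolding constant_space_def by blast
    have "mean \<nu> f = mean \<nu> (\<lambda>\<eta> :: ('d, 'x) config. c)"
      using L2 c by (intro mean_cong_AE[OF prob]) (auto simp: L2_def)
    also have "\<dots> = c" by (rule mean_const[OF prob])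
    finally have "c = 0"
      using gradient_space_properties(2)[OF prob, of f] f by simp
    with L2 c show "f \<in> null_space \<nu>" by (simp add: null_space_def)
  next
    fix f :: "('d, 'x) config \<Rightarrow> real" assume "f \<in> null_space \<nu>"
    then have L2: "f \<in> L2 (product_law \<nu>)" and AE: "AE \<eta> in product_law \<nu>. f \<eta> = 0"
      by (auto simp: null_space_def)
    then show "f \<in> constant_space \<nu> \<inter> gradient_space \<nu>"
      using gradient_space_cong_AE[OF prob gradient_space_zero[OF prob] L2 AE]
      by (auto simp: constant_space_def)
  qed
qed

end
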